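(* Let $L$ be an intermediate logic with the disjunction property. Then: (a) If a set $\mathcal{R}$ of rules is an s-basis for $L$, then $\mathcal{R}\cup\{\mathsf{DP}\}$ is an m-basis for $L$, where $\mathsf{DP}$ is the m-rule $p\lor q/p,q$. (b) If a set $\mathcal{R}$ of m-rules is an m-basis for $L$ and $q$ is a propositional variable not occurring in any rule of $\mathcal{R}$, then $\mathcal{R}^q=\{r^q: r\in\mathcal{R}\}$ is an s-basis for $L$, where for $r=\Gamma/\Delta$, $r^q$ is the rule $\bigwedge_{A\in\Gamma}A\lor q\,/\,\bigvee_{B\in\Delta}B\lor q$.
   Context: Formulas are built from a countable set of propositional variables using $\land,\lor,\to,\neg,\bot,\top$; empty conjunction is $\top$, empty disjunction is $\bot$. An intermediate logic is a set $L$ of formulas with $\mathrm{Int}\subseteq L\subsetneq$ (all formulas), closed under modus ponens and substitution; it has the disjunction property if $A\lor B\in L$ implies $A\in L$ or $B\in L$. An m-rule is a pair of finite sets of formulas $\Gamma/\Delta$; a rule is an m-rule with one conclusion. An m-rule is admissible for $L$ if for every substitution $\sigma$, $\sigma(\Gamma)\subseteq L$ implies $\sigma(\Delta)\cap L\ne\emptyset$. A structural multiple-conclusion consequence relation (m-consequence) is a relation $\vdash$ between finite sets of formulas satisfying: $A\vdash A$; $\Gamma\vdash\Delta\Rightarrow\Gamma\cup\Gamma'\vdash\Delta\cup\Delta'$; if $\Gamma,A\vdash\Delta$ and $\Gamma'\vdash A,\Delta'$ then $\Gamma\cup\Gamma'\vdash\Delta\cup\Delta'$; $\Gamma\vdash\Delta\Rightarrow\sigma(\Gamma)\vdash\sigma(\Delta)$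 for all substitutions $\sigma$. For a set $\mathcal{R}$ of m-rules, $\vdash_\mathcal{R}$ is the least m-consequence containing intuitionistic derivability $\vdash_{\mathrm{Int}}$ (axiom schemata of intuitionistic logic plus modus ponens) with $\Gamma\vdash_\mathcal{R}\Delta$ for all $\Gamma/\Delta\in\mathcal{R}$; an m-rule $\Gamma/\Delta$ is derivable from $\mathcal{R}$ if $\Gamma\vdash_\mathcal{R}\Delta$. A set of m-rules is an m-basis for $L$ if every m-rule admissible for $L$ is derivable from it; a set of rules is an s-basis for $L$ if every (single-conclusion) rule admissible for $L$ is derivable from it.
   Formalization: In (a), the rule ⊥/∅ is admissible but never derivable from R∪{DP}, so R∪{DP} is not an m-basis as claimed; instead it is shown that R∪{DP} derives every admissible m-rule with nonempty conclusion set, and that R∪{DP, ⊥/∅} is an m-basis. *)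

theory Defs
  imports Main
begin

datatype fm =
    Var nat
  | And fm fm
  | Or fm fm
  | Imp fm fm
  | Neg fm
  | Bot
  | Top

primrec fvars :: "fm \<Rightarrow> nat set" where
  "fvars (Var x) = {x}"
| "fvars (And A B) = fvars A \<union> fvars B"
| "fvars (Or A B) = fvars A \<union> fvars B"
| "fvars (Imp A B) = fvars A \<union> fvars B"
| "fvars (Neg A) = fvars A"
| "fvars Bot = {}"
| "fvars Top = {}"

primrec subst :: "(nat \<Rightarrow> fm) \<Rightarrow> fm \<Rightarrow> fm" where
  "subst s (Var x) = s x"
| "subst s (And A B) = And (subst s A) (subst s B)"
| "subst s (Or A B) = Or (subst s A) (subst s B)"
| "subst s (Imp A B) = Imp (subst s A) (subst s B)"
| "subst s (Neg A) = Neg (subst s A)"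
| "subst s Bot = Bot"
| "subst s Top = Top"

fun conj_list :: "fm list \<Rightarrow> fm" where
  "conj_list [] = Top"
| "conj_list [A] = A"
| "conj_list (A # B # As) = And A (conj_list (B # As))"

fun disj_list :: "fm list \<Rightarrow> fm" where
  "disj_list [] = Bot"
| "disj_list [A] = A"
| "disj_list (A # B # As) = Or A (disj_list (B # As))"

text \<open>Conjunctions and disjunctions over a finite set are formed along an arbitrary but fixed
  enumeration without repetitions.\<close>

definition enum_fms :: "fm set \<Rightarrow> fm list" where
  "enum_fms \<Gamma> = (SOME As. set As = \<Gamma> \<and> distinct As)"

definition big_conj :: "fm set \<Rightarrow> fm" where
  "big_conj \<Gamma> = conj_list (enum_fms \<Gamma>)"

definition big_disj :: "fm set \<Rightarrow> fm" where
  "big_disj \<Delta> = disj_list (enum_fms \<Delta>)"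

inductive int_axiom :: "fm \<Rightarrow> bool" where
  "int_axiom (Imp A (Imp B A))"
| "int_axiom (Imp (Imp A (Imp B C)) (Imp (Imp A B) (Imp A C)))"
| "int_axiom (Imp (And A B) A)"
| "int_axiom (Imp (And A B) B)"
| "int_axiom (Imp A (Imp B (And A B)))"
| "int_axiom (Imp A (Or A B))"
| "int_axiom (Imp B (Or A B))"
| "int_axiom (Imp (Imp A C) (Imp (Imp B C) (Imp (Or A B) C)))"
| "int_axiom (Imp (Neg A) (Imp A Bot))"
| "int_axiom (Imp (Imp A Bot) (Neg A))"
| "int_axiom (Imp Bot A)"
| "int_axiom Top"

inductive int_derives :: "fm set \<Rightarrow> fm \<Rightarrow> bool" for \<Gamma> :: "fm set" where
  assm: "A \<in> \<Gamma> \<Longrightarrow> int_derives \<Gamma> A"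
| ax: "int_axiom A \<Longrightarrow> int_derives \<Gamma> A"
| mp: "int_derives \<Gamma> (Imp A B) \<Longrightarrow> int_derives \<Gamma> A \<Longrightarrow> int_derives \<Gamma> B"

definition Int_logic :: "fm set" where
  "Int_logic = {A. int_derives {} A}"

definition intermediate_logic :: "fm set \<Rightarrow> bool" where
  "intermediate_logic L \<longleftrightarrow>
     Int_logic \<subseteq> L \<and> L \<noteq> UNIV \<and>
     (\<forall>A B. Imp A B \<in> L \<longrightarrow> A \<in> L \<longrightarrow> B \<in> L) \<and>
     (\<forall>s A. A \<in> L \<longrightarrow> subst s A \<in> L)"

definition disjunction_property :: "fm set \<Rightarrow> bool" where
  "disjunction_property L \<longleftrightarrow> (\<forall>A B. Or A B \<in> L \<longrightarrow> A \<in> L \<or> B \<in> L)"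

type_synonym mrule = "fm set \<times> fm set"

definition is_mrule :: "mrule \<Rightarrow> bool" where
  "is_mrule r \<longleftrightarrow> finite (fst r) \<and> finite (snd r)"

definition is_rule :: "mrule \<Rightarrow> bool" where
  "is_rule r \<longleftrightarrow> is_mrule r \<and> (\<exists>B. snd r = {B})"

definition admissible :: "fm set \<Rightarrow> mrule \<Rightarrow> bool" where
  "admissible L r \<longleftrightarrow>
     (\<forall>s. subst s ` fst r \<subseteq> L \<longrightarrow> subst s ` snd r \<inter> L \<noteq> {})"

definition m_consequence :: "(fm set \<Rightarrow> fm set \<Rightarrow> bool) \<Rightarrow> bool" where
  "m_consequence C \<longleftrightarrow>
     (\<forall>\<Gamma> \<Delta>. C \<Gamma> \<Delta> \<longrightarrow> finite \<Gamma> \<and> finite \<Delta>) \<and>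
     (\<forall>A. C {A} {A}) \<and>
     (\<forall>\<Gamma> \<Delta> \<Gamma>' \<Delta>'. finite \<Gamma>' \<longrightarrow> finite \<Delta>' \<longrightarrow> C \<Gamma> \<Delta> \<longrightarrow> C (\<Gamma> \<union> \<Gamma>') (\<Delta> \<union> \<Delta>')) \<and>
     (\<forall>\<Gamma> \<Delta> \<Gamma>' \<Delta>' A. C (insert A \<Gamma>) \<Delta> \<longrightarrow> C \<Gamma>' (insert A \<Delta>') \<longrightarrow> C (\<Gamma> \<union> \<Gamma>') (\<Delta> \<union> \<Delta>')) \<and>
     (\<forall>s \<Gamma> \<Delta>. C \<Gamma> \<Delta> \<longrightarrow> C (subst s ` \<Gamma>) (subst s ` \<Delta>))"

definition m_derives :: "mrule set \<Rightarrow> fm set \<Rightarrow> fm set \<Rightarrow> bool" where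
  "m_derives R \<Gamma> \<Delta> \<longleftrightarrow>
     (\<forall>C. m_consequence C \<longrightarrow>
          (\<forall>\<Gamma>' A. finite \<Gamma>' \<longrightarrow> int_derives \<Gamma>' A \<longrightarrow> C \<Gamma>' {A}) \<longrightarrow>
          (\<forall>(\<Gamma>', \<Delta>') \<in> R. C \<Gamma>' \<Delta>') \<longrightarrow>
          C \<Gamma> \<Delta>)"

definition derivable :: "mrule set \<Rightarrow> mrule \<Rightarrow> bool" where
  "derivable R r \<longleftrightarrow> m_derives R (fst r) (snd r)"

definition m_basis :: "fm set \<Rightarrow> mrule set \<Rightarrow> bool" where
  "m_basis L R \<longleftrightarrow>
     (\<forall>r\<in>R. is_mrule r) \<and> (\<forall>r. is_mrule r \<longrightarrow> admissible L r \<longrightarrow> derivable R r)"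

definition s_basis :: "fm set \<Rightarrow> mrule set \<Rightarrow> bool" where
  "s_basis L R \<longleftrightarrow>
     (\<forall>r\<in>R. is_rule r) \<and> (\<forall>r. is_rule r \<longrightarrow> admissible L r \<longrightarrow> derivable R r)"

definition DP_rule :: "nat \<Rightarrow> nat \<Rightarrow> mrule" where
  "DP_rule p q = ({Or (Var p) (Var q)}, {Var p, Var q})"

definition Bot_rule :: mrule where
  "Bot_rule = ({Bot}, {})"

definition q_rule :: "nat \<Rightarrow> mrule \<Rightarrow> mrule" where
  "q_rule q r = ({Or (big_conj (fst r)) (Var q)}, {Or (big_disj (snd r)) (Var q)})"

definition occurs_in_rule :: "nat \<Rightarrow> mrule \<Rightarrow> bool" where
  "occurs_in_rule q r \<longleftrightarrow> (\<exists>A \<in> fst r \<union> snd r. q \<in> fvars A)"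

text \<open>Single-conclusion rules and the disjunction rule only ever yield nonempty conclusion sets,
  whereas the m-rule with premise \<open>\<bottom>\<close> and no conclusion is admissible for every
  intermediate logic. Hence an s-basis together with the disjunction rule derives at most the
  admissible m-rules that have a conclusion; to obtain those without one as well, the m-rule
  \<open>\<bottom> / \<emptyset>\<close> has to be added. The following lemmas record this.\<close>

lemma m_derives_nonempty:
  assumes "\<forall>r\<in>R. is_mrule r \<and> snd r \<noteq> {}" and "m_derives R \<Gamma> \<Delta>"
  shows "\<Delta> \<noteq> {}"
proof -
  let ?C = "\<lambda>\<Gamma> \<Delta> :: fm set. finite \<Gamma> \<and> finite \<Delta> \<and> \<Delta> \<noteq> {}"
  have "m_consequence ?C"
    unfolding m_consequence_def by auto
  moreover have "\<forall>(\<Gamma>', \<Delta>') \<in> R. ?C \<Gamma>' \<Delta>'"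
    using assms(1) by (auto simp: is_mrule_def)
  ultimately have "?C \<Gamma> \<Delta>"
    using assms(2)[unfolded m_derives_def, rule_format, of ?C] by auto
  then show ?thesis by blast
qed

lemma admissible_Bot_rule:
  assumes "intermediate_logic L"
  shows "admissible L Bot_rule"
proof -
  have "Imp Bot A \<in> L" for A
    using assms int_derives.ax[OF int_axiom.intros(11)]
    by (auto simp: intermediate_logic_def Int_logic_def)
  then have "Bot \<notin> L"
    using assms by (auto simp: intermediate_logic_def)
  then show ?thesis
    by (auto simp: admissible_def Bot_rule_def)
qed

lemma not_m_basis_rules_DP:
  assumes "intermediate_logic L" and "\<forall>r\<in>R. is_rule r"
  shows "\<not> m_basis L (R \<union> {DP_rule p q})"
proof
  assume "m_basis L (R \<union> {DP_rule p q})"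
  then have "m_derives (R \<union> {DP_rule p q}) {Bot} {}"
    using admissible_Bot_rule[OF assms(1)]
    by (auto simp: m_basis_def derivable_def is_mrule_def Bot_rule_def)
  moreover have "\<forall>r \<in> R \<union> {DP_rule p q}. is_mrule r \<and> snd r \<noteq> {}"
    using assms(2) by (auto simp: is_rule_def is_mrule_def DP_rule_def)
  ultimately show False
    using m_derives_nonempty by blast
qed

end

(*
  (a) If \<Gamma>/\<Delta> is admissible, then so is the rule \<Gamma>/\<Or>\<Delta>, and iterating DP splits \<Or>\<Delta> into \<Delta>; the
  only use of the rule \<bottom>/\<emptyset> is to discharge the empty disjunction.
  (b) The relation "\<And>\<sigma>\<Gamma> \<or> D derives \<Or>\<sigma>\<Delta> \<or> D from R^q, for all \<sigma> and D" is an m-consequence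
  containing R: a rule of R is handled by substituting D for the fresh variable q, and cut by
  moving the side conclusions into D. For an admissible rule \<Gamma>/B take D = B and
  the identity for \<sigma>.
*)
theory Submission
  imports Defs
begin

section \<open>Intuitionistic derivability\<close>

lemma int_derives_mono:
  assumes "int_derives \<Gamma> A" and "\<Gamma> \<subseteq> \<Gamma>'"
  shows "int_derives \<Gamma>' A"
  using assms by induction (auto intro: int_derives.intros)

lemma int_derives_axiom_mp: "int_axiom (Imp A B) \<Longrightarrow> int_derives \<Gamma> A \<Longrightarrow> int_derives \<Gamma> B"
  by (rule int_derives.mp[OF int_derives.ax])

text \<open>Deduction theorem by induction on the Hilbert derivation: assumptions and axioms are
  prefixed by the first axiom schema, modus ponens is absorbed by the second, and
  \<open>Imp A A\<close> is the combinator term SKK.\<close>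

lemma int_derives_imp_intro:
  assumes "int_derives (insert A \<Gamma>) B"
  shows "int_derives \<Gamma> (Imp A B)"
  using assms
proof induction
  case (assm B)
  have "int_derives \<Gamma> (Imp A A)"
    by (rule int_derives.mp[OF int_derives_axiom_mp[OF int_axiom.intros(2)]])
      (rule int_derives.ax, rule int_axiom.intros(1))+
  moreover have "int_derives \<Gamma> (Imp A B)" if "B \<in> \<Gamma>"
    using that by (intro int_derives_axiom_mp[OF int_axiom.intros(1)] int_derives.assm)
  ultimately show ?case using assm by auto
next
  case (ax B)
  then show ?case by (intro int_derives_axiom_mp[OF int_axiom.intros(1)] int_derives.ax)
next
  case (mp B C)
  show ?case by (rule int_derives.mp[OF int_derives_axiom_mp[OF int_axiom.intros(2)] mp.IH(2)]) fact
qed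

lemma int_derives_cut:
  assumes "int_derives (insert A \<Gamma>) B" and "int_derives \<Gamma> A"
  shows "int_derives \<Gamma> B"
  using assms int_derives.mp int_derives_imp_intro by blast

lemma int_derives_subst:
  assumes "int_derives \<Gamma> A"
  shows "int_derives (subst s ` \<Gamma>) (subst s A)"
  using assms
proof induction
  case (ax A)
  then have "int_axiom (subst s A)"
    by cases (simp_all add: int_axiom.intros)
  then show ?case by (rule int_derives.ax)
qed (auto intro: int_derives.intros)

section \<open>Introduction and elimination rules for conjunction and disjunction\<close>

lemma int_derives_and_intro:
  "int_derives \<Gamma> A \<Longrightarrow> int_derives \<Gamma> B \<Longrightarrow> int_derives \<Gamma> (And A B)"
  by (rule int_derives.mp[OF int_derives_axiom_mp[OF int_axiom.intros(5)]])

lemma int_derives_and_elim1: "int_derives \<Gamma> (And A B) \<Longrightarrow> int_derives \<Gamma> A"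
  by (rule int_derives_axiom_mp[OF int_axiom.intros(3)])

lemma int_derives_and_elim2: "int_derives \<Gamma> (And A B) \<Longrightarrow> int_derives \<Gamma> B"
  by (rule int_derives_axiom_mp[OF int_axiom.intros(4)])

lemma int_derives_or_intro1: "int_derives \<Gamma> A \<Longrightarrow> int_derives \<Gamma> (Or A B)"
  by (rule int_derives_axiom_mp[OF int_axiom.intros(6)])

lemma int_derives_or_intro2: "int_derives \<Gamma> B \<Longrightarrow> int_derives \<Gamma> (Or A B)"
  by (rule int_derives_axiom_mp[OF int_axiom.intros(7)])

lemma int_derives_or_elim:
  assumes "int_derives \<Gamma> (Or A B)"
    and "int_derives (insert A \<Gamma>) C" and "int_derives (insert B \<Gamma>) C"
  shows "int_derives \<Gamma> C"
  by (rule int_derives.mp[OF int_derives.mp[OF int_derives_axiom_mp[OF int_axiom.intros(8)]]])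
    (use assms in \<open>auto intro: int_derives_imp_intro\<close>)

text \<open>Lets an intuitionistic step be carried out beside a side disjunct
  \<open>D\<close>.\<close>

lemma int_derives_or_mono:
  assumes "int_derives {A} B"
  shows "int_derives {Or A D} (Or B D)"
proof (rule int_derives_or_elim)
  show "int_derives {Or A D} (Or A D)" by (simp add: int_derives.assm)
  show "int_derives {A, Or A D} (Or B D)"
    using assms by (blast intro: int_derives_or_intro1 int_derives_mono)
  show "int_derives {D, Or A D} (Or B D)"
    by (simp add: int_derives.assm int_derives_or_intro2)
qed

section \<open>Conjunctions and disjunctions of lists and of finite sets\<close>

lemma int_derives_conj_list_elim:
  "int_derives \<Gamma> (conj_list As) \<Longrightarrow> A \<in> set As \<Longrightarrow> int_derives \<Gamma> A"
  by (induction As rule: conj_list.induct) (auto dest: int_derives_and_elim1 int_derives_and_elim2)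

lemma int_derives_conj_list_intro:
  "(\<And>A. A \<in> set As \<Longrightarrow> int_derives \<Gamma> A) \<Longrightarrow> int_derives \<Gamma> (conj_list As)"
  by (induction As rule: conj_list.induct)
    (auto intro: int_derives_and_intro int_derives.ax int_axiom.intros(12))

lemma int_derives_disj_list_intro:
  "int_derives \<Gamma> A \<Longrightarrow> A \<in> set As \<Longrightarrow> int_derives \<Gamma> (disj_list As)"
  by (induction As rule: disj_list.induct)
    (auto intro: int_derives_or_intro1 int_derives_or_intro2)

lemma int_derives_disj_list_elim:
  "int_derives \<Gamma> (disj_list As) \<Longrightarrow> (\<And>A. A \<in> set As \<Longrightarrow> int_derives (insert A \<Gamma>) C)
    \<Longrightarrow> int_derives \<Gamma> C"
proof (induction As arbitrary: \<Gamma> rule: disj_list.induct)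
  case 1
  then show ?case using int_derives_axiom_mp[OF int_axiom.intros(11)] by auto
next
  case (2 A)
  then show ?case using int_derives_cut by auto
next
  case (3 A B As)
  let ?D = "disj_list (B # As)"
  \<comment> \<open>The induction hypothesis is used in the context enlarged by \<open>?D\<close>,
    which is why \<Gamma> is generalized in the induction.\<close>
  have "int_derives (insert ?D \<Gamma>) C"
  proof (rule "3.IH")
    show "int_derives (insert ?D \<Gamma>) ?D" by (simp add: int_derives.assm)
    show "int_derives (insert X (insert ?D \<Gamma>)) C" if "X \<in> set (B # As)" for X
      using "3.prems"(2)[of X] that by (auto intro: int_derives_mono)
  qed
  then show ?case using "3.prems" by (auto intro: int_derives_or_elim)
qed

text \<open>All reasoning about \<open>enum_fms\<close> goes through this fact, so the arbitrary
  choice of an order does no harm.\<close>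

lemma set_enum_fms: "finite \<Gamma> \<Longrightarrow> set (enum_fms \<Gamma>) = \<Gamma>"
  unfolding enum_fms_def by (metis (mono_tags, lifting) finite_distinct_list someI_ex)

lemma int_derives_big_conj_elim:
  "int_derives \<Gamma> (big_conj \<Delta>) \<Longrightarrow> finite \<Delta> \<Longrightarrow> A \<in> \<Delta> \<Longrightarrow> int_derives \<Gamma> A"
  by (metis big_conj_def int_derives_conj_list_elim set_enum_fms)

lemma int_derives_big_conj_intro:
  "finite \<Delta> \<Longrightarrow> (\<And>A. A \<in> \<Delta> \<Longrightarrow> int_derives \<Gamma> A) \<Longrightarrow> int_derives \<Gamma> (big_conj \<Delta>)"
  by (metis big_conj_def int_derives_conj_list_intro set_enum_fms)

lemma int_derives_big_disj_intro:
  "int_derives \<Gamma> A \<Longrightarrow> finite \<Delta> \<Longrightarrow> A \<in> \<Delta> \<Longrightarrow> int_derives \<Gamma> (big_disj \<Delta>)"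
  by (metis big_disj_def int_derives_disj_list_intro set_enum_fms)

lemma int_derives_big_disj_elim:
  "int_derives \<Gamma> (big_disj \<Delta>) \<Longrightarrow> finite \<Delta> \<Longrightarrow> (\<And>A. A \<in> \<Delta> \<Longrightarrow> int_derives (insert A \<Gamma>) C)
    \<Longrightarrow> int_derives \<Gamma> C"
  by (metis big_disj_def int_derives_disj_list_elim set_enum_fms)

lemma int_derives_big_conj_mono:
  assumes "finite \<Gamma>" and "\<Gamma>' \<subseteq> \<Gamma>"
  shows "int_derives {big_conj \<Gamma>} (big_conj \<Gamma>')"
proof (rule int_derives_big_conj_intro)
  show "finite \<Gamma>'" using assms finite_subset by blast
  show "int_derives {big_conj \<Gamma>} A" if "A \<in> \<Gamma>'" for A
    using that assms by (blast intro: int_derives_big_conj_elim int_derives.assm)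
qed

lemma int_derives_big_disj_mono:
  assumes "finite \<Delta>'" and "\<Delta> \<subseteq> \<Delta>'"
  shows "int_derives {big_disj \<Delta>} (big_disj \<Delta>')"
proof (rule int_derives_big_disj_elim)
  show "int_derives {big_disj \<Delta>} (big_disj \<Delta>)" by (simp add: int_derives.assm)
  show "finite \<Delta>" using assms finite_subset by blast
  show "int_derives {A, big_disj \<Delta>} (big_disj \<Delta>')" if "A \<in> \<Delta>" for A
    using that assms by (auto intro: int_derives_big_disj_intro int_derives.assm)
qed

section \<open>Substitutions\<close>

lemma subst_subst: "subst s (subst t A) = subst (\<lambda>x. subst s (t x)) A"
  by (induction A) auto

lemma subst_Var: "subst Var A = A"
  by (induction A) auto

lemma subst_fun_upd_fresh: "q \<notin> fvars A \<Longrightarrow> subst (s(q := D)) A = subst s A"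
  by (induction A) auto

section \<open>Substitution in finite conjunctions and disjunctions\<close>

lemma subst_conj_list: "subst s (conj_list As) = conj_list (map (subst s) As)"
  by (induction As rule: conj_list.induct) auto

lemma subst_disj_list: "subst s (disj_list As) = disj_list (map (subst s) As)"
  by (induction As rule: disj_list.induct) auto

text \<open>A substitution may identify members of \<Gamma>, and the image is enumerated afresh, so
  the two conjunctions may differ as formulas; every conjunct on the right is nevertheless a member
  of the image.\<close>

lemma int_derives_subst_big_conj:
  assumes "finite \<Gamma>"
  shows "int_derives {big_conj (subst s ` \<Gamma>)} (subst s (big_conj \<Gamma>))"
  unfolding big_conj_def[of \<Gamma>] subst_conj_list
proof (rule int_derives_conj_list_intro)
  show "int_derives {big_conj (subst s ` \<Gamma>)} A" if "A \<in> set (map (subst s) (enum_fms \<Gamma>))" for A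
    using that assms
    by (auto simp: set_enum_fms intro: int_derives_big_conj_elim int_derives.assm)
qed

lemma int_derives_subst_big_disj:
  assumes "finite \<Delta>"
  shows "int_derives {subst s (big_disj \<Delta>)} (big_disj (subst s ` \<Delta>))"
  unfolding big_disj_def[of \<Delta>] subst_disj_list
proof (rule int_derives_disj_list_elim)
  show "int_derives {disj_list (map (subst s) (enum_fms \<Delta>))}
    (disj_list (map (subst s) (enum_fms \<Delta>)))"
    by (simp add: int_derives.assm)
  show "int_derives {A, disj_list (map (subst s) (enum_fms \<Delta>))} (big_disj (subst s ` \<Delta>))"
    if "A \<in> set (map (subst s) (enum_fms \<Delta>))" for A
    using that assms
    by (auto simp: set_enum_fms intro: int_derives_big_disj_intro int_derives.assm)
qed

section \<open>The consequence relation of a set of m-rules\<close>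

lemma m_consequence_cut:
  assumes "m_consequence C" and "C (insert A \<Gamma>) \<Delta>" and "C \<Gamma>' (insert A \<Delta>')"
  shows "C (\<Gamma> \<union> \<Gamma>') (\<Delta> \<union> \<Delta>')"
  using assms(1)[unfolded m_consequence_def, THEN conjunct2, THEN conjunct2, THEN conjunct2,
      THEN conjunct1] assms(2,3) by blast

lemma m_consequence_subst:
  assumes "m_consequence C" and "C \<Gamma> \<Delta>"
  shows "C (subst s ` \<Gamma>) (subst s ` \<Delta>)"
  using assms by (simp add: m_consequence_def)

text \<open>Leastness of \<open>m_derives R\<close>, in the form of an induction principle.\<close>

lemma m_derivesD:
  assumes "m_derives R \<Gamma> \<Delta>" and "m_consequence C"
    and "\<And>\<Gamma> A. finite \<Gamma> \<Longrightarrow> int_derives \<Gamma> A \<Longrightarrow> C \<Gamma> {A}"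
    and "\<And>\<Gamma> \<Delta>. (\<Gamma>, \<Delta>) \<in> R \<Longrightarrow> C \<Gamma> \<Delta>"
  shows "C \<Gamma> \<Delta>"
  using assms(1)[unfolded m_derives_def, THEN spec[of _ C]] assms(2-4) by auto

text \<open>\<open>m_derives R\<close> is the intersection of all m-consequences \<open>C\<close>
  that contain intuitionistic derivability and \<open>R\<close>; a closure property shared by all
  these \<open>C\<close> therefore passes to it.\<close>

lemma m_derivesI:
  assumes "\<And>C. m_consequence C \<Longrightarrow> (\<And>\<Gamma> A. finite \<Gamma> \<Longrightarrow> int_derives \<Gamma> A \<Longrightarrow> C \<Gamma> {A})
    \<Longrightarrow> (\<And>\<Gamma> \<Delta>. (\<Gamma>, \<Delta>) \<in> R \<Longrightarrow> C \<Gamma> \<Delta>) \<Longrightarrow> C \<Gamma> \<Delta>"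
  shows "m_derives R \<Gamma> \<Delta>"
  unfolding m_derives_def
proof (intro allI impI)
  fix C
  assume C: "m_consequence C" "\<forall>\<Gamma> A. finite \<Gamma> \<longrightarrow> int_derives \<Gamma> A \<longrightarrow> C \<Gamma> {A}"
    "\<forall>(\<Gamma>, \<Delta>) \<in> R. C \<Gamma> \<Delta>"
  show "C \<Gamma> \<Delta>"
    by (rule assms[OF C(1)]) (use C(2,3) in auto)
qed

lemma m_derives_int:
  assumes "finite \<Gamma>" and "int_derives \<Gamma> A"
  shows "m_derives R \<Gamma> {A}"
proof (rule m_derivesI)
  fix C :: "fm set \<Rightarrow> fm set \<Rightarrow> bool"
  assume "\<And>\<Gamma> A. finite \<Gamma> \<Longrightarrow> int_derives \<Gamma> A \<Longrightarrow> C \<Gamma> {A}"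
  from this[OF assms] show "C \<Gamma> {A}" .
qed

lemma m_derives_rule:
  assumes "(\<Gamma>, \<Delta>) \<in> R"
  shows "m_derives R \<Gamma> \<Delta>"
proof (rule m_derivesI)
  fix C :: "fm set \<Rightarrow> fm set \<Rightarrow> bool"
  assume "\<And>\<Gamma> \<Delta>. (\<Gamma>, \<Delta>) \<in> R \<Longrightarrow> C \<Gamma> \<Delta>"
  from this[OF assms] show "C \<Gamma> \<Delta>" .
qed

lemma m_derives_mono:
  assumes "m_derives R \<Gamma> \<Delta>" and "R \<subseteq> R'"
  shows "m_derives R' \<Gamma> \<Delta>"
proof (rule m_derivesI)
  fix C
  assume C: "m_consequence C" "\<And>\<Gamma> A. finite \<Gamma> \<Longrightarrow> int_derives \<Gamma> A \<Longrightarrow> C \<Gamma> {A}"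
    "\<And>\<Gamma> \<Delta>. (\<Gamma>, \<Delta>) \<in> R' \<Longrightarrow> C \<Gamma> \<Delta>"
  show "C \<Gamma> \<Delta>"
    by (rule m_derivesD[where C = C, OF assms(1) C(1,2) C(3)[OF subsetD[OF assms(2)]]])
qed

lemma m_derives_cut:
  assumes "m_derives R (insert A \<Gamma>) \<Delta>" and "m_derives R \<Gamma>' (insert A \<Delta>')"
  shows "m_derives R (\<Gamma> \<union> \<Gamma>') (\<Delta> \<union> \<Delta>')"
proof (rule m_derivesI)
  fix C
  assume C: "m_consequence C" "\<And>\<Gamma> A. finite \<Gamma> \<Longrightarrow> int_derives \<Gamma> A \<Longrightarrow> C \<Gamma> {A}"
    "\<And>\<Gamma> \<Delta>. (\<Gamma>, \<Delta>) \<in> R \<Longrightarrow> C \<Gamma> \<Delta>"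
  show "C (\<Gamma> \<union> \<Gamma>') (\<Delta> \<union> \<Delta>')"
    by (rule m_consequence_cut[of C A, OF C(1) m_derivesD[where C = C, OF assms(1) C]
          m_derivesD[where C = C, OF assms(2) C]])
qed

lemma m_derives_subst:
  assumes "m_derives R \<Gamma> \<Delta>"
  shows "m_derives R (subst s ` \<Gamma>) (subst s ` \<Delta>)"
proof (rule m_derivesI)
  fix C
  assume C: "m_consequence C" "\<And>\<Gamma> A. finite \<Gamma> \<Longrightarrow> int_derives \<Gamma> A \<Longrightarrow> C \<Gamma> {A}"
    "\<And>\<Gamma> \<Delta>. (\<Gamma>, \<Delta>) \<in> R \<Longrightarrow> C \<Gamma> \<Delta>"
  show "C (subst s ` \<Gamma>) (subst s ` \<Delta>)"
    by (rule m_consequence_subst[OF C(1) m_derivesD[where C = C, OF assms C]])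
qed

lemma m_derives_trans:
  assumes "m_derives R \<Gamma> {A}" and "m_derives R {A} \<Delta>"
  shows "m_derives R \<Gamma> \<Delta>"
  using m_derives_cut[of R A "{}" \<Delta> \<Gamma> "{}"] assms by simp

section \<open>From s-bases to m-bases\<close>

text \<open>Structurality turns the one rule DP into all its instances; since \<open>p\<close> and
  \<open>q\<close> are distinct, \<open>A\<close> and \<open>B\<close> can be chosen
  independently.\<close>

lemma m_derives_DP_or:
  assumes "DP_rule p q \<in> R" and "p \<noteq> q"
  shows "m_derives R {Or A B} {A, B}"
  using m_derives_subst[OF m_derives_rule, of _ _ R "Var(p := A, q := B)"] assms
  by (fastforce simp: DP_rule_def)

lemma m_derives_disj_list_split:
  assumes "DP_rule p q \<in> R" and "p \<noteq> q" and "As \<noteq> [] \<or> Bot_rule \<in> R"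
  shows "m_derives R {disj_list As} (set As)"
  using assms(3)
proof (induction As rule: disj_list.induct)
  case 1
  then show ?case using m_derives_rule[of "{Bot}" "{}" R] by (simp add: Bot_rule_def)
next
  case (2 A)
  then show ?case by (simp add: m_derives_int int_derives.assm)
next
  case (3 A B As)
  let ?D = "disj_list (B # As)"
  \<comment> \<open>The tail \<open>B # As\<close> is nonempty, so the induction hypothesis applies
    whether or not \<open>Bot_rule\<close> is in \<open>R\<close>.\<close>
  have "m_derives R {?D} (set (B # As))" using 3 by simp
  moreover have "m_derives R {Or A ?D} (insert ?D {A})"
    using m_derives_DP_or[OF assms(1,2), of A ?D] by (simp add: insert_commute)
  \<comment> \<open>DP splits off \<open>A\<close>, and a cut on \<open>?D\<close> replaces the
    remaining disjunction by its members.\<close>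
  ultimately have "m_derives R ({} \<union> {Or A ?D}) (set (B # As) \<union> {A})"
    by (rule m_derives_cut)
  then show ?case by (simp add: insert_commute)
qed

section \<open>Admissible m-rules and their disjunctive single-conclusion forms\<close>

lemma intermediate_logic_int_derives:
  assumes "intermediate_logic L" and "int_derives \<Gamma> A" and "\<Gamma> \<subseteq> L"
  shows "A \<in> L"
  using assms(2)
proof induction
  case (ax A)
  then show ?case
    using assms(1) by (auto simp: intermediate_logic_def Int_logic_def intro: int_derives.ax)
next
  case (mp A B)
  then show ?case using assms(1) by (auto simp: intermediate_logic_def)
qed (use assms(3) in blast)

text \<open>If \<sigma>B is in \<open>L\<close> for some B in \<Delta>, then so is
  \<sigma>(\<Or>\<Delta>), because \<open>L\<close> is closed under intuitionistic
  derivation.\<close>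

lemma admissible_big_disj:
  assumes "intermediate_logic L" and "finite \<Delta>" and "admissible L (\<Gamma>, \<Delta>)"
  shows "admissible L (\<Gamma>, {big_disj \<Delta>})"
  unfolding admissible_def
proof (intro allI impI)
  fix s assume "subst s ` fst (\<Gamma>, {big_disj \<Delta>}) \<subseteq> L"
  then obtain B where "B \<in> \<Delta>" "subst s B \<in> L"
    using assms(3) by (fastforce simp: admissible_def)
  moreover have "int_derives {subst s B} (subst s (big_disj \<Delta>))" if "B \<in> \<Delta>"
    using int_derives_subst[of "{B}" "big_disj \<Delta>" s] that assms(2)
    by (auto intro: int_derives_big_disj_intro int_derives.assm)
  ultimately show "subst s ` snd (\<Gamma>, {big_disj \<Delta>}) \<inter> L \<noteq> {}"
    using intermediate_logic_int_derives[OF assms(1)] by auto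
qed

text \<open>The s-basis derives \<Gamma>/\<Or>\<Delta>, and \<Or>\<Delta> is then split. The set
  \<open>R'\<close> is left general so that the result covers DP alone, for nonempty \<Delta>, as
  well as DP together with \<open>Bot_rule\<close>, for every \<Delta>.\<close>

lemma derivable_from_s_basis_DP:
  assumes "intermediate_logic L" and "s_basis L R" and "p \<noteq> q"
    and "R \<union> {DP_rule p q} \<subseteq> R'" and "is_mrule r" and "admissible L r"
    and "snd r \<noteq> {} \<or> Bot_rule \<in> R'"
  shows "derivable R' r"
proof -
  obtain \<Gamma> \<Delta> where r: "r = (\<Gamma>, \<Delta>)" by fastforce
  have fin: "finite \<Gamma>" "finite \<Delta>" using assms(5) by (auto simp: is_mrule_def r)
  have "admissible L (\<Gamma>, {big_disj \<Delta>})"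
    using assms(1,6) fin(2) by (auto simp: r intro: admissible_big_disj)
  then have "m_derives R \<Gamma> {big_disj \<Delta>}"
    using assms(2) fin by (auto simp: s_basis_def is_rule_def is_mrule_def derivable_def)
  then have "m_derives R' \<Gamma> {big_disj \<Delta>}"
    using assms(4) by (blast intro: m_derives_mono)
  moreover have "m_derives R' {big_disj \<Delta>} \<Delta>"
    using m_derives_disj_list_split[of p q R' "enum_fms \<Delta>"] assms(3,4,7) set_enum_fms[OF fin(2)]
    by (fastforce simp: big_disj_def r)
  ultimately show ?thesis
    by (auto simp: derivable_def r intro: m_derives_trans)
qed

section \<open>From m-bases to s-bases\<close>

text \<open>Quantifying over \<open>s\<close> builds in closure under substitution. Quantifying over
  \<open>D\<close> provides room for the side conclusions of a cut and makes \<open>D\<close>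
  available as the value of the fresh variable.\<close>

definition disj_stable :: "mrule set \<Rightarrow> fm set \<Rightarrow> fm set \<Rightarrow> bool" where
  "disj_stable R \<Gamma> \<Delta> \<longleftrightarrow> finite \<Gamma> \<and> finite \<Delta> \<and>
     (\<forall>s D. m_derives R {Or (big_conj (subst s ` \<Gamma>)) D} {Or (big_disj (subst s ` \<Delta>)) D})"

lemma disj_stable_int:
  assumes "finite \<Gamma>" and "int_derives \<Gamma> A"
  shows "disj_stable R \<Gamma> {A}"
proof -
  have "int_derives {big_conj (subst s ` \<Gamma>)} (big_disj (subst s ` {A}))" for s
  proof (rule int_derives_big_disj_intro)
    \<comment> \<open>A derivation from the set becomes one from its conjunction once each
      assumption is replaced by a projection.\<close>
    have "int_derives {big_conj (subst s ` \<Gamma>)} C" if "int_derives (subst s ` \<Gamma>) C" for C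
      using that
    proof induction
      case (assm B)
      then show ?case
        using assms(1) by (blast intro: int_derives_big_conj_elim int_derives.assm)
    qed (auto intro: int_derives.intros)
    then show "int_derives {big_conj (subst s ` \<Gamma>)} (subst s A)"
      using assms(2) int_derives_subst by blast
  qed auto
  then show ?thesis
    using assms(1) by (auto simp: disj_stable_def intro!: m_derives_int int_derives_or_mono)
qed

text \<open>Enlarging \<Gamma> strengthens the conjunction and enlarging \<Delta> weakens the
  disjunction, so intuitionistic steps on both sides suffice.\<close>

lemma disj_stable_weaken:
  assumes "disj_stable R \<Gamma> \<Delta>" and "finite \<Gamma>'" and "finite \<Delta>'"
  shows "disj_stable R (\<Gamma> \<union> \<Gamma>') (\<Delta> \<union> \<Delta>')"
proof -
  have fin: "finite \<Gamma>" "finite \<Delta>" using assms(1) by (auto simp: disj_stable_def)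
  have "m_derives R {Or (big_conj (subst s ` (\<Gamma> \<union> \<Gamma>'))) D}
    {Or (big_disj (subst s ` (\<Delta> \<union> \<Delta>'))) D}" for s D
  proof (rule m_derives_trans[OF m_derives_trans])
    show "m_derives R {Or (big_conj (subst s ` (\<Gamma> \<union> \<Gamma>'))) D} {Or (big_conj (subst s ` \<Gamma>)) D}"
      using fin assms
      by (intro m_derives_int int_derives_or_mono int_derives_big_conj_mono) auto
    show "m_derives R {Or (big_conj (subst s ` \<Gamma>)) D} {Or (big_disj (subst s ` \<Delta>)) D}"
      using assms(1) by (simp add: disj_stable_def)
    show "m_derives R {Or (big_disj (subst s ` \<Delta>)) D} {Or (big_disj (subst s ` (\<Delta> \<union> \<Delta>'))) D}"
      using fin assms
      by (intro m_derives_int int_derives_or_mono int_derives_big_disj_mono) auto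
  qed
  then show ?thesis using fin assms by (simp add: disj_stable_def)
qed

text \<open>Distributivity: among the disjuncts of the first premise, \<open>A\<close> joins the
  conjunction of \<Gamma> from the second premise, while members of \<Delta> and \<open>D\<close> go
  to the side disjunct.\<close>

lemma int_derives_side_conclusion_in:
  assumes "finite \<Gamma>" and "finite \<Delta>"
  shows "int_derives {Or (big_disj (insert A \<Delta>)) D, Or (big_conj \<Gamma>) D}
    (Or (big_conj (insert A \<Gamma>)) (Or (big_disj \<Delta>) D))" (is "int_derives _ ?G")
proof (rule int_derives_or_elim[of _ "big_disj (insert A \<Delta>)" D])
  have D: "int_derives X ?G" if "D \<in> X" for X
    using that by (intro int_derives_or_intro2 int_derives.assm)
  show "int_derives (insert D {Or (big_disj (insert A \<Delta>)) D, Or (big_conj \<Gamma>) D}) ?G"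
    by (rule D) simp
  show "int_derives (insert (big_disj (insert A \<Delta>))
      {Or (big_disj (insert A \<Delta>)) D, Or (big_conj \<Gamma>) D}) ?G" (is "int_derives ?X _")
  proof (rule int_derives_or_elim[of _ "big_conj \<Gamma>" D])
    show "int_derives (insert (big_conj \<Gamma>) ?X) ?G" (is "int_derives ?Y _")
    proof (rule int_derives_big_disj_elim[of _ "insert A \<Delta>"])
      fix B assume B: "B \<in> insert A \<Delta>"
      show "int_derives (insert B ?Y) ?G"
      proof (cases "B \<in> \<Delta>")
        case True
        then have "int_derives (insert B ?Y) (big_disj \<Delta>)"
          using assms(2) by (intro int_derives_big_disj_intro[of _ B] int_derives.assm) simp_all
        then show ?thesis by (intro int_derives_or_intro2[OF int_derives_or_intro1])
      next
        case False
        with B have "B = A" by blast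
        moreover have "int_derives (insert A ?Y) C" if "C \<in> \<Gamma>" for C
          by (rule int_derives_big_conj_elim[of _ \<Gamma>])
            (use that assms(1) in \<open>simp_all add: int_derives.assm\<close>)
        moreover have "int_derives (insert A ?Y) A" by (simp add: int_derives.assm)
        ultimately have "int_derives (insert B ?Y) C" if "C \<in> insert A \<Gamma>" for C
          using that by blast
        then have "int_derives (insert B ?Y) (big_conj (insert A \<Gamma>))"
          using assms(1) by (intro int_derives_big_conj_intro) simp_all
        then show ?thesis by (rule int_derives_or_intro1)
      qed
    qed (use assms in \<open>simp_all add: int_derives.assm\<close>)
    show "int_derives (insert D ?X) ?G" by (rule D) simp
  qed (simp_all add: int_derives.assm)
qed (simp_all add: int_derives.assm)

text \<open>Reassociates the disjunction, returning the side conclusions from the side disjunct to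
  the main one.\<close>

lemma int_derives_side_conclusion_out:
  assumes "finite \<Delta>" and "finite \<Delta>'"
  shows "int_derives {Or (big_disj \<Delta>) (Or (big_disj \<Delta>') D)} (Or (big_disj (\<Delta> \<union> \<Delta>')) D)"
    (is "int_derives {?P} ?G")
proof (rule int_derives_or_elim[of _ "big_disj \<Delta>" "Or (big_disj \<Delta>') D"])
  have *: "int_derives X ?G" if "big_disj \<Theta> \<in> X" "\<Theta> \<subseteq> \<Delta> \<union> \<Delta>'" for X \<Theta>
  proof (rule int_derives_or_intro1)
    have "int_derives {big_disj \<Theta>} (big_disj (\<Delta> \<union> \<Delta>'))"
      using assms that(2) by (simp add: int_derives_big_disj_mono)
    then show "int_derives X (big_disj (\<Delta> \<union> \<Delta>'))"
      by (rule int_derives_mono) (use that(1) in simp)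
  qed
  show "int_derives {big_disj \<Delta>, ?P} ?G" by (rule *[of \<Delta>]) simp_all
  show "int_derives {Or (big_disj \<Delta>') D, ?P} ?G" (is "int_derives ?X _")
  proof (rule int_derives_or_elim[of _ "big_disj \<Delta>'" D])
    show "int_derives (insert (big_disj \<Delta>') ?X) ?G" by (rule *[of "\<Delta>'"]) simp_all
    show "int_derives (insert D ?X) ?G" by (simp add: int_derives_or_intro2 int_derives.assm)
  qed (simp_all add: int_derives.assm)
qed (simp_all add: int_derives.assm)

text \<open>The second assumption yields \<open>A\<close>, a member of \<Delta>' or
  \<open>D\<close>. The last two are stored in a new side disjunct \<Or>\<Delta>' \<or> D, and the
  first assumption is applied with this disjunct in place of \<open>D\<close>.\<close>

lemma disj_stable_cut:
  assumes "disj_stable R (insert A \<Gamma>) \<Delta>" and "disj_stable R \<Gamma>' (insert A \<Delta>')"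
  shows "disj_stable R (\<Gamma> \<union> \<Gamma>') (\<Delta> \<union> \<Delta>')"
proof -
  have fin: "finite \<Gamma>" "finite \<Delta>" "finite \<Gamma>'" "finite \<Delta>'"
    using assms by (auto simp: disj_stable_def)
  have "m_derives R {Or (big_conj (subst s ` (\<Gamma> \<union> \<Gamma>'))) D}
    {Or (big_disj (subst s ` (\<Delta> \<union> \<Delta>'))) D}" for s D
  proof -
    let ?c = "\<lambda>\<Theta>. big_conj (subst s ` \<Theta>)" and ?d = "\<lambda>\<Theta>. big_disj (subst s ` \<Theta>)"
    let ?X = "Or (?c (\<Gamma> \<union> \<Gamma>')) D" and ?Y = "Or (?d (insert A \<Delta>')) D"
      and ?Z = "Or (?c (insert A (\<Gamma> \<union> \<Gamma>'))) (Or (?d \<Delta>') D)"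
    have Y: "m_derives R {?X} {?Y}"
    proof (rule m_derives_trans)
      show "m_derives R {?X} {Or (?c \<Gamma>') D}"
        using fin by (intro m_derives_int int_derives_or_mono int_derives_big_conj_mono) blast+
      show "m_derives R {Or (?c \<Gamma>') D} {?Y}"
        using assms(2) by (simp only: disj_stable_def)
    qed
    \<comment> \<open>\<open>?X\<close> is kept beside \<open>?Y\<close>: in the case of
      \<open>A\<close> it still supplies the members of \<Gamma>, needed for the first
      assumption.\<close>
    have "m_derives R {?Y, ?X} {?Z}"
      unfolding image_insert using fin
      by (intro m_derives_int int_derives_side_conclusion_in) simp_all
    then have "m_derives R {?X} {?Z}"
      using m_derives_cut[of R ?Y "{?X}" "{?Z}" "{?X}" "{}"] Y by simp
    also have "m_derives R {?Z} {Or (?c (insert A \<Gamma>)) (Or (?d \<Delta>') D)}"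
      using fin by (intro m_derives_int int_derives_or_mono int_derives_big_conj_mono) blast+
    also (m_derives_trans) have
      "m_derives R {Or (?c (insert A \<Gamma>)) (Or (?d \<Delta>') D)} {Or (?d \<Delta>) (Or (?d \<Delta>') D)}"
      using assms(1) by (simp only: disj_stable_def)
    also (m_derives_trans) have
      "m_derives R {Or (?d \<Delta>) (Or (?d \<Delta>') D)} {Or (?d (\<Delta> \<union> \<Delta>')) D}"
      using fin
      by (intro m_derives_int) (simp, unfold image_Un, rule int_derives_side_conclusion_out, simp_all)
    finally (m_derives_trans) show ?thesis .
  qed
  then show ?thesis using fin by (simp add: disj_stable_def)
qed

lemma m_consequence_disj_stable: "m_consequence (disj_stable R)"
  unfolding m_consequence_def
proof (intro conjI allI impI)
  show "disj_stable R {A} {A}" for A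
    by (simp add: disj_stable_int int_derives.assm)
  show "finite \<Gamma>" "finite \<Delta>" if "disj_stable R \<Gamma> \<Delta>" for \<Gamma> \<Delta>
    using that by (simp_all add: disj_stable_def)
  \<comment> \<open>The composite of two substitutions is again among the substitutions quantified
    over in \<open>disj_stable\<close>.\<close>
  show "disj_stable R (subst s ` \<Gamma>) (subst s ` \<Delta>)" if "disj_stable R \<Gamma> \<Delta>" for s \<Gamma> \<Delta>
    using that by (simp add: disj_stable_def image_image subst_subst)
qed (rule disj_stable_weaken disj_stable_cut, assumption+)+

section \<open>Transfer of derivability from R to R^q\<close>

lemma disj_stable_q_rule:
  assumes "(\<Gamma>, \<Delta>) \<in> R" and "is_mrule (\<Gamma>, \<Delta>)" and "\<not> occurs_in_rule q (\<Gamma>, \<Delta>)"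
  shows "disj_stable (q_rule q ` R) \<Gamma> \<Delta>"
proof -
  let ?R = "q_rule q ` R"
  have fin: "finite \<Gamma>" "finite \<Delta>" using assms(2) by (auto simp: is_mrule_def)
  have "m_derives ?R {Or (big_conj (subst s ` \<Gamma>)) D} {Or (big_disj (subst s ` \<Delta>)) D}" for s D
  proof (rule m_derives_trans[OF m_derives_trans])
    \<comment> \<open>As \<open>q\<close> does not occur in the rule, \<open>?s\<close> acts on
      \<Gamma> and \<Delta> as \<open>s\<close> does, while it turns the side variable of the
      transformed rule into \<open>D\<close>.\<close>
    let ?s = "s(q := D)"
    have eq: "subst s ` \<Gamma> = subst ?s ` \<Gamma>" "subst s ` \<Delta> = subst ?s ` \<Delta>"
      using assms(3) by (auto simp: occurs_in_rule_def subst_fun_upd_fresh intro!: image_cong)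
    show "m_derives ?R {Or (big_conj (subst s ` \<Gamma>)) D} {Or (subst ?s (big_conj \<Gamma>)) D}"
      unfolding eq using fin
      by (intro m_derives_int int_derives_or_mono int_derives_subst_big_conj) auto
    have "({Or (big_conj \<Gamma>) (Var q)}, {Or (big_disj \<Delta>) (Var q)}) \<in> ?R"
      using assms(1) by (force simp: q_rule_def)
    from m_derives_subst[OF m_derives_rule[OF this], of ?s]
    show "m_derives ?R {Or (subst ?s (big_conj \<Gamma>)) D} {Or (subst ?s (big_disj \<Delta>)) D}" by simp
    show "m_derives ?R {Or (subst ?s (big_disj \<Delta>)) D} {Or (big_disj (subst s ` \<Delta>)) D}"
      unfolding eq using fin
      by (intro m_derives_int int_derives_or_mono int_derives_subst_big_disj) auto
  qed
  then show ?thesis using fin by (simp add: disj_stable_def)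
qed

lemma m_derives_q_rule:
  assumes "\<forall>r\<in>R. is_mrule r" and "\<forall>r\<in>R. \<not> occurs_in_rule q r" and "m_derives R \<Gamma> {B}"
  shows "m_derives (q_rule q ` R) \<Gamma> {B}"
proof -
  let ?R = "q_rule q ` R"
  have stable: "disj_stable ?R \<Gamma> {B}"
    by (rule m_derivesD[where C = "disj_stable ?R", OF assms(3) m_consequence_disj_stable])
      (use assms(1,2) in \<open>auto intro: disj_stable_int disj_stable_q_rule\<close>)
  have fin: "finite \<Gamma>" using stable by (simp add: disj_stable_def)
  show ?thesis
  proof (rule m_derives_trans[OF m_derives_trans])
    show "m_derives ?R \<Gamma> {Or (big_conj \<Gamma>) B}"
      using fin
      by (intro m_derives_int int_derives_or_intro1 int_derives_big_conj_intro int_derives.assm)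
    \<comment> \<open>The instance with identity substitution \<open>Var\<close> and side disjunct
      \<open>B\<close>: both disjuncts of the result then yield \<open>B\<close>.\<close>
    show "m_derives ?R {Or (big_conj \<Gamma>) B} {Or (big_disj {B}) B}"
      using stable[unfolded disj_stable_def, THEN conjunct2, THEN conjunct2, rule_format, of Var B]
      by (simp add: subst_Var)
    have *: "int_derives {big_disj {B}, Or (big_disj {B}) B} B"
      by (rule int_derives_big_disj_elim[of _ "{B}"]) (simp_all add: int_derives.assm)
    have "int_derives {Or (big_disj {B}) B} B"
      by (rule int_derives_or_elim[of _ "big_disj {B}" B])
        (use * in \<open>simp_all add: int_derives.assm\<close>)
    then show "m_derives ?R {Or (big_disj {B}) B} {B}" by (simp add: m_derives_int)
  qed
qed

text \<open>An admissible rule is in particular an admissible m-rule, hence derivable from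
  \<open>R\<close>; its single conclusion allows the transfer to the transformed rules.\<close>

lemma s_basis_q_rule:
  assumes "m_basis L R" and "\<forall>r\<in>R. \<not> occurs_in_rule q r"
  shows "s_basis L (q_rule q ` R)"
  unfolding s_basis_def
proof (intro conjI allI impI)
  show "\<forall>r\<in>q_rule q ` R. is_rule r"
    by (auto simp: is_rule_def is_mrule_def q_rule_def)
  fix r assume r: "is_rule r" "admissible L r"
  then obtain B where B: "snd r = {B}" by (auto simp: is_rule_def)
  have "m_derives R (fst r) {B}"
    using assms(1) r unfolding m_basis_def is_rule_def derivable_def B[symmetric] by blast
  then have "m_derives (q_rule q ` R) (fst r) {B}"
    using assms by (intro m_derives_q_rule) (simp_all add: m_basis_def)
  then show "derivable (q_rule q ` R) r" by (simp add: derivable_def B)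
qed

theorem mainTheorem7:
  fixes L :: "fm set"
  assumes "intermediate_logic L" and "disjunction_property L"
  shows "(\<forall>R p q. s_basis L R \<longrightarrow> p \<noteq> q \<longrightarrow>
            (\<forall>r. is_mrule r \<longrightarrow> snd r \<noteq> {} \<longrightarrow> admissible L r \<longrightarrow>
                 derivable (R \<union> {DP_rule p q}) r) \<and>
            m_basis L (R \<union> {DP_rule p q, Bot_rule})) \<and>
         (\<forall>R q. m_basis L R \<longrightarrow> (\<forall>r\<in>R. \<not> occurs_in_rule q r) \<longrightarrow>
            s_basis L (q_rule q ` R))"
proof (intro conjI allI impI)
  fix R :: "mrule set" and p q :: nat
  assume R: "s_basis L R" and pq: "p \<noteq> q"
  show "derivable (R \<union> {DP_rule p q}) r"
    if "is_mrule r" "snd r \<noteq> {}" "admissible L r" for r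
    by (rule derivable_from_s_basis_DP[OF assms(1) R pq]) (use that in auto)
  have "\<forall>r \<in> R \<union> {DP_rule p q, Bot_rule}. is_mrule r"
    using R by (auto simp: s_basis_def is_rule_def) (auto simp: is_mrule_def DP_rule_def Bot_rule_def)
  \<comment> \<open>Here the presence of \<open>Bot_rule\<close> covers the m-rules with empty
    conclusion as well.\<close>
  moreover have "derivable (R \<union> {DP_rule p q, Bot_rule}) r" if "is_mrule r" "admissible L r" for r
    by (rule derivable_from_s_basis_DP[OF assms(1) R pq]) (use that in auto)
  ultimately show "m_basis L (R \<union> {DP_rule p q, Bot_rule})"
    by (simp add: m_basis_def)
qed (rule s_basis_q_rule)

end
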